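(* Let $M\in\mathbb{R}^{n\times n}$ be symmetric positive definite. Then the Jacobi preconditioner $\bar D=\operatorname{Diag}(\operatorname{diag}(M))^{-1}$ is an $\omega$-optimal diagonal scaling, i.e. $$\bar D\in\operatorname{argmin}\left\{\omega(D^{1/2}MD^{1/2}): D \text{ diagonal},\ \operatorname{diag}(D)\in\mathbb{R}^n_{++}\right\}.$$
   Context: For a symmetric positive definite $n\times n$ matrix $S$, $\omega(S)=\dfrac{\operatorname{trace}(S)/n}{\det(S)^{1/n}}$. $\operatorname{diag}(S)$ is the vector of diagonal entries of $S$, $\operatorname{Diag}(d)$ the diagonal matrix with diagonal $d$, and $\mathbb{R}^n_{++}$ the set of vectors with strictly positive entries. *)

theory Defs
  imports "HOL-Analysis.Analysis"
begin

definition symmetric_matrix :: "real^'n^'n \<Rightarrow> bool" where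
  "symmetric_matrix S \<longleftrightarrow> transpose S = S"

definition sym_pos_def :: "real^'n^'n \<Rightarrow> bool" where
  "sym_pos_def S \<longleftrightarrow> symmetric_matrix S \<and> (\<forall>x. x \<noteq> 0 \<longrightarrow> 0 < x \<bullet> (S *v x))"

definition sym_pos_semidef :: "real^'n^'n \<Rightarrow> bool" where
  "sym_pos_semidef S \<longleftrightarrow> symmetric_matrix S \<and> (\<forall>x. 0 \<le> x \<bullet> (S *v x))"

definition diag_vec :: "real^'n^'n \<Rightarrow> real^'n" where
  "diag_vec S = (\<chi> i. S $ i $ i)"

definition Diag :: "real^'n \<Rightarrow> real^'n^'n" where
  "Diag d = (\<chi> i j. if i = j then d $ i else 0)"

definition is_diagonal :: "real^'n^'n \<Rightarrow> bool" where
  "is_diagonal D \<longleftrightarrow> (\<forall>i j. i \<noteq> j \<longrightarrow> D $ i $ j = 0)"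

definition positive_vec :: "real^'n \<Rightarrow> bool" where
  "positive_vec d \<longleftrightarrow> (\<forall>i. 0 < d $ i)"

text \<open>The principal square root, i.e. the positive semidefinite one. It is meaningful only
  where a unique such root exists; see \<open>matrix_sqrt_Diag\<close> for diagonal matrices with
  positive diagonal.\<close>

definition matrix_sqrt :: "real^'n^'n \<Rightarrow> real^'n^'n" where
  "matrix_sqrt S = (THE R. sym_pos_semidef R \<and> R ** R = S)"

text \<open>Used only for symmetric positive definite arguments, where the determinant is positive.\<close>

definition omega :: "real^'n^'n \<Rightarrow> real" where
  "omega S = (trace S / real CARD('n)) / root CARD('n) (det S)"

lemma Diag_mult_vec: "Diag d *v x = (\<chi> i. d $ i * x $ i)"
  by (simp add: Diag_def matrix_vector_mult_def vec_eq_iff if_distrib if_distribR cong: if_cong)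

lemma Diag_mult_left: "(Diag d ** A) $ i $ j = d $ i * A $ i $ j"
  by (simp add: Diag_def matrix_matrix_mult_def if_distrib if_distribR cong: if_cong)

lemma Diag_mult_right: "(A ** Diag d) $ i $ j = A $ i $ j * d $ j"
proof -
  have "(A ** Diag d) $ i $ j = (\<Sum>k\<in>UNIV. if k = j then A $ i $ k * d $ k else 0)"
    unfolding matrix_matrix_mult_def Diag_def vec_lambda_beta by (rule sum.cong) auto
  then show ?thesis by simp
qed

lemma matrix_sqrt_Diag:
  fixes d :: "real^'n"
  assumes "positive_vec d"
  shows "matrix_sqrt (Diag d) = Diag (\<chi> i. sqrt (d $ i))"
proof -
  define S where "S = Diag (\<chi> i. sqrt (d $ i))"
  have pos: "0 < d $ i" for i using assms by (simp add: positive_vec_def)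
  have SS: "S ** S = Diag d"
    by (simp add: vec_eq_iff S_def Diag_mult_left) (simp add: Diag_def pos less_imp_le)
  have symS: "symmetric_matrix S"
    by (auto simp: symmetric_matrix_def S_def Diag_def transpose_def vec_eq_iff)
  have quad: "x \<bullet> (S *v x) = (\<Sum>i\<in>UNIV. sqrt (d $ i) * (x $ i)\<^sup>2)" for x
    by (simp add: S_def Diag_mult_vec inner_vec_def power2_eq_square mult_ac)
  have S0: "0 \<le> x \<bullet> (S *v x)" for x
    unfolding quad by (intro sum_nonneg) (simp add: pos less_imp_le)
  have Spos: "x = 0" if "x \<bullet> (S *v x) \<le> 0" for x
  proof -
    have "x \<bullet> (S *v x) = 0" using that S0[of x] by linarith
    then have "\<forall>i\<in>UNIV. sqrt (d $ i) * (x $ i)\<^sup>2 = 0"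
      unfolding quad by (subst (asm) sum_nonneg_eq_0_iff) (auto simp: pos less_imp_le)
    moreover have "sqrt (d $ i) \<noteq> 0" for i using pos[of i] by simp
    ultimately show ?thesis by (simp add: vec_eq_iff)
  qed
  have uniq: "R = S" if R: "sym_pos_semidef R" and RR: "R ** R = Diag d" for R
  proof -
    have comm: "R ** Diag d = Diag d ** R"
      by (simp flip: RR add: matrix_mul_assoc)
    have "R $ i $ j * sqrt (d $ j) = sqrt (d $ i) * R $ i $ j" for i j
    proof -
      have "R $ i $ j * d $ j = d $ i * R $ i $ j"
        using arg_cong[OF comm, of "\<lambda>A. A $ i $ j"] by (simp add: Diag_mult_left Diag_mult_right)
      then show ?thesis by auto
    qed
    then have RS: "R ** S = S ** R"
      by (simp add: vec_eq_iff S_def Diag_mult_left Diag_mult_right)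
    have "(R - S) *v x = 0" for x
    proof -
      let ?y = "(R - S) *v x"
      have "R *v ?y + S *v ?y = (R ** R - R ** S + S ** R - S ** S) *v x"
        by (simp add: matrix_vector_mul_assoc[symmetric] matrix_vector_mult_diff_rdistrib
            matrix_vector_mult_add_rdistrib matrix_vector_mult_diff_distrib)
      also have "\<dots> = 0" by (simp add: RR SS RS)
      finally have "?y \<bullet> (R *v ?y) + ?y \<bullet> (S *v ?y) = 0"
        by (simp flip: inner_add_right)
      moreover have "0 \<le> ?y \<bullet> (R *v ?y)" using R by (simp add: sym_pos_semidef_def)
      ultimately show ?thesis using Spos[of ?y] by linarith
    qed
    then have "R - S = 0" by (simp add: matrix_eq)
    then show ?thesis by simp
  qed
  have "matrix_sqrt (Diag d) = S"
    unfolding matrix_sqrt_def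
    by (rule the_equality) (use SS symS S0 uniq in \<open>auto simp: sym_pos_semidef_def\<close>)
  then show ?thesis by (simp add: S_def)
qed

end

theory Submission
  imports Defs
begin

text \<open>A diagonal scaling multiplies \<open>det M\<close> and the product of the diagonal entries of \<open>M\<close> by the
  same factor. By the inequality of arithmetic and geometric means, every scaling therefore has an
  \<open>\<omega>\<close>-value of at least the \<open>n\<close>-th root of \<open>(\<Prod>i. M\<^sub>i\<^sub>i) / det M\<close>. The Jacobi scaling attains this
  bound, because it makes all diagonal entries equal to 1.\<close>

text \<open>A kernel vector \<open>x\<close> gives \<open>x \<bullet> (S *v x) = 0\<close>, so
  definiteness makes the kernel trivial.\<close>

lemma sym_pos_def_det_nonzero:
  fixes S :: "real^'n^'n"
  assumes "sym_pos_def S"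
  shows "det S \<noteq> 0"
proof -
  have "\<forall>x. S *v x = 0 \<longrightarrow> x = 0"
    using assms unfolding sym_pos_def_def by (metis inner_zero_right less_irrefl)
  then show ?thesis
    using invertible_det_nz invertible_left_inverse matrix_left_invertible_ker by metis
qed

text \<open>The determinant does not vanish on the segment from the identity to \<open>S\<close>, so it keeps its
  sign there.\<close>

lemma sym_pos_def_det_pos:
  fixes S :: "real^'n^'n"
  assumes "sym_pos_def S"
  shows "0 < det S"
proof (rule ccontr)
  assume neg: "\<not> 0 < det S"
  define A where "A t = (1 - t) *\<^sub>R mat 1 + t *\<^sub>R S" for t :: real
  have spd: "sym_pos_def (A t)" if t: "0 \<le> t" "t \<le> 1" for t
  proof -
    have "transpose (A t) = A t"
      using assms by (auto simp: A_def sym_pos_def_def symmetric_matrix_def transpose_def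
          vec_eq_iff mat_def)
    moreover have "0 < x \<bullet> (A t *v x)" if "x \<noteq> 0" for x
    proof -
      have S: "0 < x \<bullet> (S *v x)" using assms that by (simp add: sym_pos_def_def)
      have "x \<bullet> (A t *v x) = (1 - t) * (x \<bullet> x) + t * (x \<bullet> (S *v x))"
        by (simp add: A_def matrix_vector_mult_add_rdistrib inner_add_right
            flip: scaleR_matrix_vector_assoc)
      \<comment> \<open>For \<open>t > 0\<close> the second summand is positive and the first
        nonnegative (it vanishes at \<open>t = 1\<close>); for \<open>t = 0\<close> only
        \<open>x \<bullet> x\<close> remains.\<close>
      also have "\<dots> > 0"
      proof (cases "t = 0")
        case False
        then have "0 < t" using t by simp
        then show ?thesis using t S by (simp add: add_nonneg_pos)
      qed (use that in simp)
      finally show ?thesis .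
    qed
    ultimately show ?thesis by (simp add: sym_pos_def_def symmetric_matrix_def)
  qed
  have "continuous_on {0..1} (\<lambda>t. det (A t))"
    unfolding det_def A_def by (simp, intro continuous_intros)
  then obtain t where "0 \<le> t" "t \<le> 1" "det (A t) = 0"
    using IVT2'[of "\<lambda>t. det (A t)" 1 0 0] neg by (auto simp: A_def)
  with spd sym_pos_def_det_nonzero show False by blast
qed

text \<open>The quadratic form of \<open>S\<close> takes the value \<open>S $ i $ i\<close> at the
  basis vector \<open>axis i 1\<close>.\<close>

lemma sym_pos_def_diag_pos:
  fixes S :: "real^'n^'n"
  assumes "sym_pos_def S"
  shows "0 < S $ i $ i"
proof -
  have "0 < axis i 1 \<bullet> (S *v axis i 1)"
    using assms by (simp add: sym_pos_def_def axis_eq_0_iff)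
  then show ?thesis
    by (simp add: inner_axis' matrix_vector_mul_component inner_axis)
qed

lemma det_Diag: "det (Diag d) = (\<Prod>i\<in>UNIV. d $ i)"
  by (subst det_diagonal) (auto simp: Diag_def)

lemma diagonal_eq_Diag: "is_diagonal D \<Longrightarrow> D = Diag (diag_vec D)"
  by (auto simp: is_diagonal_def Diag_def diag_vec_def vec_eq_iff)

lemma is_diagonal_Diag: "is_diagonal (Diag d)"
  by (simp add: is_diagonal_def Diag_def)

lemma diag_vec_Diag [simp]: "diag_vec (Diag d) = d"
  by (simp add: Diag_def diag_vec_def vec_eq_iff)

lemma matrix_inv_Diag:
  fixes d :: "real^'n"
  assumes "\<And>i. d $ i \<noteq> 0"
  shows "matrix_inv (Diag d) = Diag (\<chi> i. inverse (d $ i))"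
proof -
  let ?E = "Diag (\<chi> i. inverse (d $ i))"
  have inv: "Diag d ** ?E = mat 1" "?E ** Diag d = mat 1"
    by (simp_all add: vec_eq_iff Diag_mult_left) (simp_all add: Diag_def mat_def assms)
  \<comment> \<open>\<open>matrix_inv\<close> is given by a choice operator, so uniqueness of the
    inverse is what identifies the chosen matrix.\<close>
  have "B = ?E" if "Diag d ** B = mat 1" for B
    using inv(2) that by (metis matrix_mul_assoc matrix_mul_lid matrix_mul_rid)
  then show ?thesis
    unfolding matrix_inv_def using inv by (blast intro: some_equality)
qed

text \<open>The factor \<open>sqrt (d $ i)\<close> enters the \<open>i\<close>-th diagonal entry
  once from the left and once from the right. The two outer determinants likewise multiply to the
  product of the entries of \<open>d\<close>.\<close>

lemma omega_diagonal_scaling: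
  fixes M :: "real^'n^'n" and d :: "real^'n"
  assumes "positive_vec d"
  shows "omega (matrix_sqrt (Diag d) ** M ** matrix_sqrt (Diag d)) =
    ((\<Sum>i\<in>UNIV. d $ i * M $ i $ i) / CARD('n)) / root CARD('n) ((\<Prod>i\<in>UNIV. d $ i) * det M)"
proof -
  let ?R = "Diag (\<chi> i. sqrt (d $ i))"
  have d: "0 \<le> d $ i" for i using assms by (simp add: positive_vec_def less_imp_le)
  have "(?R ** M ** ?R) $ i $ i = d $ i * M $ i $ i" for i
    by (simp add: Diag_mult_left Diag_mult_right d)
  then have "trace (?R ** M ** ?R) = (\<Sum>i\<in>UNIV. d $ i * M $ i $ i)"
    by (simp add: trace_def)
  moreover have "det (?R ** M ** ?R) = (\<Prod>i\<in>UNIV. d $ i) * det M"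
  proof -
    have "det ?R * det ?R = (\<Prod>i\<in>UNIV. d $ i)"
      by (simp add: det_Diag d flip: prod.distrib)
    then show ?thesis by (simp add: det_mul mult_ac)
  qed
  ultimately show ?thesis
    by (simp add: omega_def matrix_sqrt_Diag[OF assms])
qed

lemma omega_diagonal_scaling_ge:
  fixes M :: "real^'n^'n" and d :: "real^'n"
  assumes "sym_pos_def M" "positive_vec d"
  shows "root CARD('n) ((\<Prod>i\<in>UNIV. M $ i $ i) / det M)
    \<le> omega (matrix_sqrt (Diag d) ** M ** matrix_sqrt (Diag d))"
proof -
  let ?p = "\<Prod>i\<in>UNIV. d $ i"
  have d: "0 < d $ i" for i using assms by (simp add: positive_vec_def)
  have M: "0 < M $ i $ i" for i using assms by (simp add: sym_pos_def_diag_pos)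
  have p: "0 < ?p" using d by (simp add: prod_pos)
  have det: "0 < det M" using assms by (simp add: sym_pos_def_det_pos)
  have pos: "0 < (\<Prod>i\<in>UNIV. d $ i * M $ i $ i)" by (simp add: prod_pos d M)
  \<comment> \<open>Expanding by \<open>?p\<close> makes the denominator the determinant of the
    scaled matrix and the numerator the product of its diagonal entries.\<close>
  have "(\<Prod>i\<in>UNIV. M $ i $ i) / det M = (\<Prod>i\<in>UNIV. d $ i * M $ i $ i) / (?p * det M)"
    using mult_divide_mult_cancel_left[of ?p "\<Prod>i\<in>UNIV. M $ i $ i" "det M"] p
    unfolding prod.distrib by linarith
  then have "root CARD('n) ((\<Prod>i\<in>UNIV. M $ i $ i) / det M) =
      root CARD('n) (\<Prod>i\<in>UNIV. d $ i * M $ i $ i) / root CARD('n) (?p * det M)"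
    by (simp add: real_root_divide)
  also have "\<dots> \<le> ((\<Sum>i\<in>UNIV. d $ i * M $ i $ i) / CARD('n)) / root CARD('n) (?p * det M)"
  proof (rule divide_right_mono)
    \<comment> \<open>Arithmetic-geometric mean inequality for the diagonal entries of the scaled
      matrix.\<close>
    show "root CARD('n) (\<Prod>i\<in>UNIV. d $ i * M $ i $ i) \<le> (\<Sum>i\<in>UNIV. d $ i * M $ i $ i) / CARD('n)"
      using arith_geom_mean[of UNIV "\<lambda>i. d $ i * M $ i $ i"] d M pos
      by (simp add: root_powr_inverse sum_divide_distrib less_imp_le)
    show "0 \<le> root CARD('n) (?p * det M)"
      using p det by simp
  qed
  finally show ?thesis
    by (simp add: omega_diagonal_scaling[OF assms(2)])
qed

theorem corollary3p2:
  fixes M :: "real^'n^'n"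
  assumes "sym_pos_def M"
  shows "is_arg_min (\<lambda>D. omega (matrix_sqrt D ** M ** matrix_sqrt D))
           (\<lambda>D. is_diagonal D \<and> positive_vec (diag_vec D))
           (matrix_inv (Diag (diag_vec M)))"
proof -
  define e :: "real^'n" where "e = (\<chi> i. inverse (M $ i $ i))"
  have M: "0 < M $ i $ i" for i using assms by (rule sym_pos_def_diag_pos)
  then have nz: "M $ i $ i \<noteq> 0" for i by (metis less_irrefl)
  have inv: "matrix_inv (Diag (diag_vec M)) = Diag e"
    by (subst matrix_inv_Diag) (simp_all add: diag_vec_def e_def nz)
  have e: "positive_vec e" by (simp add: e_def positive_vec_def M)
  have prod: "(\<Prod>i\<in>UNIV. e $ i) = inverse (\<Prod>i\<in>UNIV. M $ i $ i)"
    by (simp add: e_def prod_inversef[symmetric] o_def)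
  have sum: "(\<Sum>i\<in>UNIV. e $ i * M $ i $ i) = CARD('n)"
    by (simp add: e_def nz)
  \<comment> \<open>By \<open>sum\<close> the arithmetic mean is 1, and by \<open>prod\<close> the
    remaining root is that of \<open>det M\<close> over the product of the diagonal of
    \<open>M\<close>.\<close>
  have opt: "omega (matrix_sqrt (Diag e) ** M ** matrix_sqrt (Diag e)) =
      root CARD('n) ((\<Prod>i\<in>UNIV. M $ i $ i) / det M)"
    unfolding omega_diagonal_scaling[OF e] prod sum
    by (simp add: real_root_divide real_root_mult real_root_inverse field_simps)
  show ?thesis
    unfolding is_arg_min_def inv
  proof (intro conjI notI)
    assume "\<exists>D. (is_diagonal D \<and> positive_vec (diag_vec D)) \<and>
      omega (matrix_sqrt D ** M ** matrix_sqrt D)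
        < omega (matrix_sqrt (Diag e) ** M ** matrix_sqrt (Diag e))"
    then obtain D where D: "is_diagonal D" "positive_vec (diag_vec D)"
      and "omega (matrix_sqrt D ** M ** matrix_sqrt D)
        < root CARD('n) ((\<Prod>i\<in>UNIV. M $ i $ i) / det M)"
      unfolding opt by blast
    \<comment> \<open>A feasible \<open>D\<close> equals \<open>Diag (diag_vec D)\<close>, so the
      lower bound applies to it.\<close>
    with omega_diagonal_scaling_ge[OF assms D(2)] show False
      by (simp flip: diagonal_eq_Diag)
  qed (simp_all add: is_diagonal_Diag e)
qed

end
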